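(* Consider the 10-dimensional mapping $$(x_0,x_1,x_2,x_3,y_0,y_1,y_2,z_1,z_2,z_3)\mapsto(x_1,x_2,x_3,x_4,y_1,y_2,y_3,z_2,z_3,z_4),$$ where $y_3$, then $z_4$, and then $x_4$ are determined, in this order, by taking $n=0$ in $$a\,x_{n+2}y_{n+1}+b\,x_ny_{n+3}=(a+b)\,x_{n+3}y_n,$$ $$a\,y_{n+2}z_{n+2}+d\,y_nz_{n+4}=(a+d)\,y_{n+3}z_{n+1},$$ $$a\,x_{n+2}z_{n+3}+c\,x_{n+4}z_{n+1}=(a+c)\,x_{n+1}z_{n+4},$$ respectively, with parameters $a,b,c,d$. This mapping has the Laurent property.
   Context: A map is said to have the Laurent property if, for all $n$, the denominator of its $n$-th iterate is a product of powers of the initial values, i.e. if all iterates are Laurent polynomials in the initial values; here the initial values are $x_0,x_1,x_2,x_3,y_0,y_1,y_2,z_1,z_2,z_3$, and the parameters $a,b,c,d$ are regarded as constants. The mapping is the $(2,1)$-periodic reduction of a higher Gel'fand-Dikii lattice system, in which $a=p-q$, $b=q-\omega_1(p)$, $c=q-\omega_2(p)$, $d=q-\omega_3(p)$, where $p,q$ are lattice parameters and $p,\omega_1(p),\omega_2(p),\omega_3(p)$ are the roots $\omega$ of $\omega^4+\alpha\omega^3+\beta\omega^2+\gamma\omega=p^4+\alpha p^3+\beta p^2+\gamma p$ for constants $\alpha,\beta,\gamma$. *)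

theory Defs
  imports
    Main
    "HOL-Library.Poly_Mapping"
    "HOL-Computational_Algebra.Fraction_Field"
begin

section \<open>Rational functions, Laurent polynomials and the Laurent property\<close>

text \<open>
  \<^typ>\<open>('v \<Rightarrow>\<^sub>0 nat) \<Rightarrow>\<^sub>0 'k\<close> is the polynomial ring over \<^typ>\<open>'k\<close> in the variables \<^typ>\<open>'v\<close>:
  a polynomial maps each exponent vector to its coefficient. The linear order on \<^typ>\<open>'v\<close>
  is irrelevant for the mathematics; the library uses it to show that this ring is a domain.
\<close>

type_synonym ('v, 'k) ratfun = "(('v \<Rightarrow>\<^sub>0 nat) \<Rightarrow>\<^sub>0 'k) fract"

definition Const :: "'k \<Rightarrow> ('v::linorder, 'k::field) ratfun" where
  "Const a = Fract (Poly_Mapping.single 0 a) 1"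

definition Var :: "'v \<Rightarrow> ('v::linorder, 'k::field) ratfun" where
  "Var v = Fract (Poly_Mapping.single (Poly_Mapping.single v 1) 1) 1"

text \<open>\<^term>\<open>Poly_Mapping.single e 1\<close> is the monomial with exponent vector \<^term>\<open>e\<close>.\<close>

definition is_laurent :: "('v::linorder, 'k::field) ratfun \<Rightarrow> bool" where
  "is_laurent f \<longleftrightarrow> (\<exists>p e. f = Fract p (Poly_Mapping.single e 1))"

definition laurent_property ::
    "(('v \<Rightarrow> ('v, 'k) ratfun) \<Rightarrow> ('v \<Rightarrow> ('v::linorder, 'k::field) ratfun)) \<Rightarrow> bool" where
  "laurent_property \<phi> \<longleftrightarrow> (\<forall>n v. is_laurent ((\<phi> ^^ n) Var v))"


section \<open>The mapping\<close>

datatype coord = X0 | X1 | X2 | X3 | Y0 | Y1 | Y2 | Z1 | Z2 | Z3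

primrec coord_index :: "coord \<Rightarrow> nat" where
  "coord_index X0 = 0"
| "coord_index X1 = 1"
| "coord_index X2 = 2"
| "coord_index X3 = 3"
| "coord_index Y0 = 4"
| "coord_index Y1 = 5"
| "coord_index Y2 = 6"
| "coord_index Z1 = 7"
| "coord_index Z2 = 8"
| "coord_index Z3 = 9"

lemma coord_index_inject: "coord_index u = coord_index v \<Longrightarrow> u = v"
  by (cases u; cases v) simp_all

instantiation coord :: linorder
begin

definition less_eq_coord :: "coord \<Rightarrow> coord \<Rightarrow> bool" where
  "u \<le> v \<longleftrightarrow> coord_index u \<le> coord_index v"

definition less_coord :: "coord \<Rightarrow> coord \<Rightarrow> bool" where
  "u < v \<longleftrightarrow> coord_index u < coord_index v"

instance
  by standard (auto simp: less_eq_coord_def less_coord_def intro: coord_index_inject)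

end

text \<open>
  The coordinates are \<open>x\<^sub>0,\<dots>,x\<^sub>3,y\<^sub>0,y\<^sub>1,y\<^sub>2,z\<^sub>1,z\<^sub>2,z\<^sub>3\<close>; lemma \<open>gd_map_eq_iff\<close> below recovers
  the three defining relations of the mapping, which are linear in \<open>y\<^sub>3\<close>, \<open>z\<^sub>4\<close>, \<open>x\<^sub>4\<close>.
\<close>

definition gd_map :: "'f \<Rightarrow> 'f \<Rightarrow> 'f \<Rightarrow> 'f \<Rightarrow> (coord \<Rightarrow> 'f::field) \<Rightarrow> coord \<Rightarrow> 'f" where
  "gd_map a b c d s =
    (let y3 = ((a + b) * s X3 * s Y0 - a * s X2 * s Y1) / (b * s X0);
         z4 = ((a + d) * y3 * s Z1 - a * s Y2 * s Z2) / (d * s Y0);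
         x4 = ((a + c) * s X1 * z4 - a * s X2 * s Z3) / (c * s Z1)
     in (\<lambda>v. case v of
           X0 \<Rightarrow> s X1 | X1 \<Rightarrow> s X2 | X2 \<Rightarrow> s X3 | X3 \<Rightarrow> x4
         | Y0 \<Rightarrow> s Y1 | Y1 \<Rightarrow> s Y2 | Y2 \<Rightarrow> y3
         | Z1 \<Rightarrow> s Z2 | Z2 \<Rightarrow> s Z3 | Z3 \<Rightarrow> z4))"

lemma gd_map_eq_iff:
  fixes a b c d :: "'f::field"
  assumes "b * s X0 \<noteq> 0" "d * s Y0 \<noteq> 0" "c * s Z1 \<noteq> 0"
  shows "gd_map a b c d s = t \<longleftrightarrow>
    t X0 = s X1 \<and> t X1 = s X2 \<and> t X2 = s X3 \<and>
    t Y0 = s Y1 \<and> t Y1 = s Y2 \<and> t Z1 = s Z2 \<and> t Z2 = s Z3 \<and>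
    a * s X2 * s Y1 + b * s X0 * t Y2 = (a + b) * s X3 * s Y0 \<and>
    a * s Y2 * s Z2 + d * s Y0 * t Z3 = (a + d) * t Y2 * s Z1 \<and>
    a * s X2 * s Z3 + c * t X3 * s Z1 = (a + c) * s X1 * t Z3"
proof -
  define y3 where "y3 = ((a + b) * s X3 * s Y0 - a * s X2 * s Y1) / (b * s X0)"
  define z4 where "z4 = ((a + d) * y3 * s Z1 - a * s Y2 * s Z2) / (d * s Y0)"
  define x4 where "x4 = ((a + c) * s X1 * z4 - a * s X2 * s Z3) / (c * s Z1)"
  have split: "(\<forall>v::coord. P v) \<longleftrightarrow> P X0 \<and> P X1 \<and> P X2 \<and> P X3 \<and> P Y0 \<and> P Y1 \<and> P Y2
      \<and> P Z1 \<and> P Z2 \<and> P Z3" for P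
    by (metis coord.exhaust)
  have map: "gd_map a b c d s = t \<longleftrightarrow>
      t X0 = s X1 \<and> t X1 = s X2 \<and> t X2 = s X3 \<and>
      t Y0 = s Y1 \<and> t Y1 = s Y2 \<and> t Z1 = s Z2 \<and> t Z2 = s Z3 \<and>
      t Y2 = y3 \<and> t Z3 = z4 \<and> t X3 = x4"
    unfolding fun_eq_iff split gd_map_def Let_def coord.case y3_def z4_def x4_def
    by (auto simp only:)
  have solve: "w = p / q \<longleftrightarrow> r + q * w = r + p" if "q \<noteq> 0" for p q r w :: 'f
    using that by (auto simp: field_simps)
  have y3: "t Y2 = y3 \<longleftrightarrow> a * s X2 * s Y1 + b * s X0 * t Y2 = (a + b) * s X3 * s Y0"
    unfolding y3_def solve[OF assms(1), of _ _ "a * s X2 * s Y1"] by simp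
  have z4: "t Z3 = z4 \<longleftrightarrow> a * s Y2 * s Z2 + d * s Y0 * t Z3 = (a + d) * y3 * s Z1"
    unfolding z4_def solve[OF assms(2), of _ _ "a * s Y2 * s Z2"] by simp
  have x4: "t X3 = x4 \<longleftrightarrow> a * s X2 * s Z3 + c * t X3 * s Z1 = (a + c) * s X1 * z4"
    unfolding x4_def solve[OF assms(3), of _ _ "a * s X2 * s Z3"]
    by (simp add: mult.assoc mult.left_commute mult.commute)
  show ?thesis
    unfolding map using y3 z4 x4 by metis
qed


section \<open>The divisions occurring along the generic orbit are legitimate\<close>

text \<open>
  In Isabelle/HOL \<open>x / 0 = 0\<close>. The iterates considered in \<^const>\<open>laurent_property\<close> never use this
  convention: every coordinate of every iterate takes the value \<open>1\<close> when all variables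
  are set to \<open>1\<close>.
\<close>

definition eval1 :: "('m \<Rightarrow>\<^sub>0 'k::field) \<Rightarrow> 'k" where
  "eval1 p = (\<Sum>m\<in>Poly_Mapping.keys p. Poly_Mapping.lookup p m)"

lemma eval1_single [simp]: "eval1 (Poly_Mapping.single m a) = a"
  by (simp add: eval1_def)

lemma eval1_zero [simp]: "eval1 0 = 0"
  by (simp add: eval1_def)

lemma eval1_one [simp]: "eval1 (1 :: 'm::zero \<Rightarrow>\<^sub>0 'k::field) = 1"
  by (simp add: eval1_def)

lemma eval1_add [simp]: "eval1 (p + q) = eval1 p + eval1 q"
  unfolding eval1_def by (rule setsum_keys_plus_distrib) simp_all

lemma eval1_diff [simp]: "eval1 (p - q) = eval1 p - eval1 q"
  using eval1_add[of "p - q" q] by (simp del: eval1_add)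

lemma eval1_sum: "eval1 (sum f A) = (\<Sum>i\<in>A. eval1 (f i))"
  by (induction A rule: infinite_finite_induct) simp_all

lemma poly_mapping_sum_single:
  fixes p :: "'m \<Rightarrow>\<^sub>0 'k::field"
  shows "p = (\<Sum>m\<in>Poly_Mapping.keys p. Poly_Mapping.single m (Poly_Mapping.lookup p m))"
proof (rule poly_mapping_eqI)
  fix k
  have "Poly_Mapping.lookup (\<Sum>m\<in>Poly_Mapping.keys p. Poly_Mapping.single m (Poly_Mapping.lookup p m)) k
      = (\<Sum>m\<in>Poly_Mapping.keys p. if m = k then Poly_Mapping.lookup p m else 0)"
    by (simp add: lookup_sum lookup_single when_def)
  also have "\<dots> = Poly_Mapping.lookup p k"
    by (simp add: in_keys_iff)
  finally show "Poly_Mapping.lookup p k =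
      Poly_Mapping.lookup (\<Sum>m\<in>Poly_Mapping.keys p. Poly_Mapping.single m (Poly_Mapping.lookup p m)) k" ..
qed

lemma eval1_mult [simp]:
  fixes p q :: "'m::comm_monoid_add \<Rightarrow>\<^sub>0 'k::field"
  shows "eval1 (p * q) = eval1 p * eval1 q"
proof -
  have "p * q = (\<Sum>m\<in>Poly_Mapping.keys p. Poly_Mapping.single m (Poly_Mapping.lookup p m)) *
      (\<Sum>m\<in>Poly_Mapping.keys q. Poly_Mapping.single m (Poly_Mapping.lookup q m))"
    using poly_mapping_sum_single by metis
  also have "\<dots> = (\<Sum>m\<in>Poly_Mapping.keys p. \<Sum>n\<in>Poly_Mapping.keys q.
      Poly_Mapping.single (m + n) (Poly_Mapping.lookup p m * Poly_Mapping.lookup q n))"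
    by (simp add: sum_product mult_single)
  finally show ?thesis
    by (simp add: eval1_sum sum_product) (simp add: eval1_def sum_product)
qed

definition value1 :: "('v::linorder, 'k::field) ratfun \<Rightarrow> 'k \<Rightarrow> bool" where
  "value1 f r \<longleftrightarrow> (\<exists>p q. f = Fract p q \<and> eval1 q \<noteq> 0 \<and> r = eval1 p / eval1 q)"

lemma value1_Const: "value1 (Const a) a"
  unfolding value1_def Const_def
  by (rule exI[of _ "Poly_Mapping.single 0 a"], rule exI[of _ 1]) simp

lemma value1_Var: "value1 (Var v) 1"
  unfolding value1_def Var_def
  by (rule exI[of _ "Poly_Mapping.single (Poly_Mapping.single v 1) 1"], rule exI[of _ 1]) simp

lemma eval1_nonzero: "eval1 q \<noteq> 0 \<Longrightarrow> q \<noteq> 0"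
  by auto

lemma value1_add: "value1 f r \<Longrightarrow> value1 g s \<Longrightarrow> value1 (f + g) (r + s)"
  unfolding value1_def
  by (elim exE conjE, rule_tac x = "p * qa + pa * q" in exI, rule_tac x = "q * qa" in exI)
    (simp add: eval1_nonzero add_frac_eq)

lemma value1_diff: "value1 f r \<Longrightarrow> value1 g s \<Longrightarrow> value1 (f - g) (r - s)"
  unfolding value1_def
  by (elim exE conjE, rule_tac x = "p * qa - pa * q" in exI, rule_tac x = "q * qa" in exI)
    (simp add: eval1_nonzero diff_frac_eq)

lemma value1_mult: "value1 f r \<Longrightarrow> value1 g s \<Longrightarrow> value1 (f * g) (r * s)"
  unfolding value1_def
  by (elim exE conjE, rule_tac x = "p * pa" in exI, rule_tac x = "q * qa" in exI) simp

lemma value1_divide: "value1 f r \<Longrightarrow> value1 g s \<Longrightarrow> s \<noteq> 0 \<Longrightarrow> value1 (f / g) (r / s)"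
  unfolding value1_def
  by (elim exE conjE, rule_tac x = "p * qa" in exI, rule_tac x = "q * pa" in exI) simp

lemma value1_nonzero:
  assumes "value1 f r" "r \<noteq> 0"
  shows "f \<noteq> 0"
proof
  assume "f = 0"
  obtain p q where pq: "f = Fract p q" "eval1 q \<noteq> 0" "r = eval1 p / eval1 q"
    using assms(1) unfolding value1_def by blast
  have "p = 0"
    using pq(1) \<open>f = 0\<close> eval1_nonzero[OF pq(2)] by (simp add: Zero_fract_def eq_fract)
  with pq(3) assms(2) show False
    by simp
qed

lemma value1_gd_map:
  assumes "b \<noteq> 0" "c \<noteq> 0" "d \<noteq> 0" and s: "\<And>v. value1 (s v) 1"
  shows "value1 (gd_map (Const a) (Const b) (Const c) (Const d) s v) 1"
proof -
  define y3 where "y3 = ((Const a + Const b) * s X3 * s Y0 - Const a * s X2 * s Y1) / (Const b * s X0)"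
  define z4 where "z4 = ((Const a + Const d) * y3 * s Z1 - Const a * s Y2 * s Z2) / (Const d * s Y0)"
  define x4 where "x4 = ((Const a + Const c) * s X1 * z4 - Const a * s X2 * s Z3) / (Const c * s Z1)"
  have step: "value1 (((Const a + Const e) * f * g - Const a * h * k) / (Const e * l)) 1"
    if "e \<noteq> 0" "value1 f 1" "value1 g 1" "value1 h 1" "value1 k 1" "value1 l 1" for e f g h k l
  proof -
    have "value1 (((Const a + Const e) * f * g - Const a * h * k) / (Const e * l))
        (((a + e) * 1 * 1 - a * 1 * 1) / (e * 1))"
      using that by (intro value1_divide value1_diff value1_mult value1_add value1_Const) simp_all
    with that(1) show ?thesis by simp
  qed
  have y3: "value1 y3 1" unfolding y3_def using assms by (intro step)
  have z4: "value1 z4 1" unfolding z4_def using assms y3 by (intro step)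
  have x4: "value1 x4 1" unfolding x4_def using assms z4 by (intro step)
  have "gd_map (Const a) (Const b) (Const c) (Const d) s =
      (\<lambda>v. case v of X0 \<Rightarrow> s X1 | X1 \<Rightarrow> s X2 | X2 \<Rightarrow> s X3 | X3 \<Rightarrow> x4
         | Y0 \<Rightarrow> s Y1 | Y1 \<Rightarrow> s Y2 | Y2 \<Rightarrow> y3
         | Z1 \<Rightarrow> s Z2 | Z2 \<Rightarrow> s Z3 | Z3 \<Rightarrow> z4)"
    by (simp only: gd_map_def Let_def y3_def z4_def x4_def)
  then show ?thesis
    using s y3 z4 x4 by (cases v) simp_all
qed

lemma gd_map_iterate_nonzero:
  assumes "b \<noteq> 0" "c \<noteq> 0" "d \<noteq> 0"
  shows "(gd_map (Const a) (Const b) (Const c) (Const d) ^^ n) Var v \<noteq> 0"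
proof -
  have "value1 ((gd_map (Const a) (Const b) (Const c) (Const d) ^^ n) Var v) 1" for v
    by (induction n arbitrary: v) (simp_all add: value1_Var value1_gd_map assms)
  then show ?thesis
    using value1_nonzero zero_neq_one by metis
qed

end

theory Submission
  imports Defs "HOL-Computational_Algebra.Polynomial_Factorial"
begin

text \<open>
  Listing the variables as \<open>u\<^sub>0, \<dots>, u\<^sub>9 = x\<^sub>0, y\<^sub>0, z\<^sub>1, x\<^sub>1, y\<^sub>1, z\<^sub>2, x\<^sub>2, y\<^sub>2, z\<^sub>3, x\<^sub>3\<close>, all three
  relations become the single recurrence
  \<open>u\<^sub>n u\<^sub>n\<^sub>+\<^sub>1\<^sub>0 = A\<^sub>n u\<^sub>n\<^sub>+\<^sub>9 u\<^sub>n\<^sub>+\<^sub>1 - B\<^sub>n u\<^sub>n\<^sub>+\<^sub>6 u\<^sub>n\<^sub>+\<^sub>4\<close> with coefficients of period 3, and one step of the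
  mapping is three steps of the recurrence. Its Laurent property holds over the integers with the six
  coefficients as independent polynomial variables, so degenerate parameters need no separate treatment.

  The terms up to \<open>u\<^sub>1\<^sub>9\<close> are divided by initial variables only, and \<open>u\<^sub>2\<^sub>0\<close> is a Laurent polynomial
  by singularity confinement. For larger \<open>n\<close>, induction applied to the clusters \<open>(u\<^sub>1, \<dots>, u\<^sub>1\<^sub>0)\<close> and
  \<open>(u\<^sub>1\<^sub>1, \<dots>, u\<^sub>2\<^sub>0)\<close> writes \<open>u\<^sub>n\<close> with denominator a power of \<open>u\<^sub>1\<^sub>0\<close>, and with denominator a power
  of \<open>u\<^sub>1\<^sub>1 \<cdots> u\<^sub>2\<^sub>0\<close>. As \<open>u\<^sub>1\<^sub>0\<close> is prime in the Laurent ring (it has degree 1 in \<open>A\<^sub>0\<close>) and divides none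
  of \<open>u\<^sub>1\<^sub>1, \<dots>, u\<^sub>2\<^sub>0\<close>, both denominators are trivial.
\<close>

section \<open>Evaluation of integer polynomials\<close>

type_synonym zpoly = "(nat \<Rightarrow>\<^sub>0 nat) \<Rightarrow>\<^sub>0 int"

definition indet :: "nat \<Rightarrow> zpoly" where
  "indet i = Poly_Mapping.single (Poly_Mapping.single i 1) 1"

definition eval_monom :: "(nat \<Rightarrow> 'f::comm_ring_1) \<Rightarrow> (nat \<Rightarrow>\<^sub>0 nat) \<Rightarrow> 'f" where
  "eval_monom t m = (\<Prod>i\<in>Poly_Mapping.keys m. t i ^ Poly_Mapping.lookup m i)"

definition eval_zpoly :: "(nat \<Rightarrow> 'f::comm_ring_1) \<Rightarrow> zpoly \<Rightarrow> 'f" where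
  "eval_zpoly t p = (\<Sum>m\<in>Poly_Mapping.keys p. of_int (Poly_Mapping.lookup p m) * eval_monom t m)"

lemma sum_single_keys:
  fixes p :: "'m \<Rightarrow>\<^sub>0 'k::comm_monoid_add"
  shows "(\<Sum>m\<in>Poly_Mapping.keys p. Poly_Mapping.single m (Poly_Mapping.lookup p m)) = p"
proof (rule poly_mapping_eqI)
  fix k
  have "Poly_Mapping.lookup (\<Sum>m\<in>Poly_Mapping.keys p. Poly_Mapping.single m (Poly_Mapping.lookup p m)) k
      = (\<Sum>m\<in>Poly_Mapping.keys p. if m = k then Poly_Mapping.lookup p m else 0)"
    by (simp add: lookup_sum lookup_single when_def)
  also have "\<dots> = Poly_Mapping.lookup p k"
    by (simp add: in_keys_iff)
  finally show "Poly_Mapping.lookup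
      (\<Sum>m\<in>Poly_Mapping.keys p. Poly_Mapping.single m (Poly_Mapping.lookup p m)) k =
      Poly_Mapping.lookup p k" .
qed

lemma eval_monom_superset:
  assumes "finite S" "Poly_Mapping.keys m \<subseteq> S"
  shows "eval_monom t m = (\<Prod>i\<in>S. t i ^ Poly_Mapping.lookup m i)"
  unfolding eval_monom_def using assms
  by (intro prod.mono_neutral_left) (auto simp: in_keys_iff)

lemma eval_monom_add: "eval_monom t (m + n) = eval_monom t m * eval_monom t n"
proof -
  let ?S = "Poly_Mapping.keys m \<union> Poly_Mapping.keys n"
  have "eval_monom t (m + n) = (\<Prod>i\<in>?S. t i ^ Poly_Mapping.lookup (m + n) i)"
    by (rule eval_monom_superset) (use keys_add[of m n] in auto)
  also have "\<dots> = (\<Prod>i\<in>?S. t i ^ Poly_Mapping.lookup m i) * (\<Prod>i\<in>?S. t i ^ Poly_Mapping.lookup n i)"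
    by (simp add: lookup_add power_add prod.distrib)
  also have "\<dots> = eval_monom t m * eval_monom t n"
    by (simp add: eval_monom_superset[of ?S])
  finally show ?thesis .
qed

lemma eval_monom_single: "eval_monom t (Poly_Mapping.single i k) = t i ^ k"
  by (subst eval_monom_superset[of "{i}"]) auto

lemma eval_monom_0 [simp]: "eval_monom t 0 = 1"
  by (simp add: eval_monom_def)

lemma eval_zpoly_single: "eval_zpoly t (Poly_Mapping.single m c) = of_int c * eval_monom t m"
  by (simp add: eval_zpoly_def)

lemma eval_zpoly_indet [simp]: "eval_zpoly t (indet i) = t i"
  by (simp add: indet_def eval_zpoly_single eval_monom_single)

lemma eval_zpoly_0 [simp]: "eval_zpoly t 0 = 0"
  by (simp add: eval_zpoly_def)

lemma eval_zpoly_1 [simp]: "eval_zpoly t 1 = 1"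
  using eval_zpoly_single[of t 0 1] by simp

lemma eval_zpoly_add [simp]: "eval_zpoly t (p + q) = eval_zpoly t p + eval_zpoly t q"
  unfolding eval_zpoly_def by (rule setsum_keys_plus_distrib) (simp_all add: distrib_right)

lemma eval_zpoly_diff [simp]: "eval_zpoly t (p - q) = eval_zpoly t p - eval_zpoly t q"
  using eval_zpoly_add[of t "p - q" q] by (simp del: eval_zpoly_add)

lemma eval_zpoly_sum: "eval_zpoly t (sum f A) = (\<Sum>i\<in>A. eval_zpoly t (f i))"
  by (induction A rule: infinite_finite_induct) simp_all

lemma eval_zpoly_mult [simp]: "eval_zpoly t (p * q) = eval_zpoly t p * eval_zpoly t q"
proof -
  have "eval_zpoly t (p * q) =
      eval_zpoly t ((\<Sum>m\<in>Poly_Mapping.keys p. Poly_Mapping.single m (Poly_Mapping.lookup p m)) *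
        (\<Sum>m\<in>Poly_Mapping.keys q. Poly_Mapping.single m (Poly_Mapping.lookup q m)))"
    by (simp add: sum_single_keys)
  also have "\<dots> = (\<Sum>m\<in>Poly_Mapping.keys p. \<Sum>n\<in>Poly_Mapping.keys q.
      (of_int (Poly_Mapping.lookup p m) * eval_monom t m) *
      (of_int (Poly_Mapping.lookup q n) * eval_monom t n))"
    by (simp add: sum_product mult_single eval_zpoly_sum eval_zpoly_single eval_monom_add mult_ac)
  also have "\<dots> = eval_zpoly t p * eval_zpoly t q"
    by (simp add: sum_product eval_zpoly_def)
  finally show ?thesis .
qed

lemma eval_zpoly_power [simp]: "eval_zpoly t (p ^ n) = eval_zpoly t p ^ n"
  by (induction n) simp_all

lemma eval_zpoly_prod: "eval_zpoly t (prod f A) = (\<Prod>i\<in>A. eval_zpoly t (f i))"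
  by (induction A rule: infinite_finite_induct) simp_all

lemma indet_power: "indet i ^ n = Poly_Mapping.single (Poly_Mapping.single i n) 1"
  by (induction n) (simp_all add: indet_def mult_single single_add[symmetric] flip: single_one)

text \<open>Constants and indeterminates generate the ring, since monomials are products of powers
  of indeterminates. Properties closed under sums and products then need no computation with
  coefficients.\<close>

lemma zpoly_induct [case_names const indet add mult]:
  assumes const: "\<And>c. P (Poly_Mapping.single 0 c)" and indet: "\<And>i. P (indet i)"
    and add: "\<And>p q. P p \<Longrightarrow> P q \<Longrightarrow> P (p + q)" and mult: "\<And>p q. P p \<Longrightarrow> P q \<Longrightarrow> P (p * q)"
  shows "P p"
proof -
  have one: "P 1" and zero: "P 0"
    using const[of 1] const[of 0] by simp_all
  have pow: "P (indet i ^ n)" for i n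
    by (induction n) (simp_all add: one indet mult)
  have "P (Poly_Mapping.single (\<Sum>i\<in>A. Poly_Mapping.single i (f i)) 1)" if "finite A" for A f
    using that
  proof (induction A rule: finite_induct)
    case empty
    show ?case by (simp add: one)
  next
    case (insert i A)
    have "Poly_Mapping.single (\<Sum>i\<in>insert i A. Poly_Mapping.single i (f i)) (1::int) =
        indet i ^ f i * Poly_Mapping.single (\<Sum>i\<in>A. Poly_Mapping.single i (f i)) 1"
      using insert.hyps by (simp add: indet_power mult_single)
    with mult[OF pow insert.IH] show ?case by simp
  qed
  from this[of "Poly_Mapping.keys m" "Poly_Mapping.lookup m" for m]
  have monom: "P (Poly_Mapping.single m 1)" for m
    by (simp add: sum_single_keys)
  have single: "P (Poly_Mapping.single m c)" for m c
    using mult[OF const monom, of c m] by (simp add: mult_single)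
  have "P (\<Sum>m\<in>A. Poly_Mapping.single m (f m))" if "finite A" for A f
    using that by (induction A rule: finite_induct) (simp_all add: zero add single)
  from this[of "Poly_Mapping.keys p" "Poly_Mapping.lookup p"] show ?thesis
    by (simp add: sum_single_keys)
qed


section \<open>The universal Laurent ring\<close>

text \<open>Indices 0 to 9 are the initial values \<open>u\<^sub>i\<close>, which may be inverted; 10 to 12 are the
  coefficients \<open>A\<^sub>0, A\<^sub>1, A\<^sub>2\<close> and 13 to 15 are \<open>B\<^sub>0, B\<^sub>1, B\<^sub>2\<close>, which may not.\<close>

abbreviation X :: "nat \<Rightarrow> zpoly fract" where
  "X i \<equiv> to_fract (indet i)"

text \<open>Powers of the single product of all ten initial values suffice as denominators; adding
  exponents yields a common denominator of two elements.\<close>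

definition laurent_ring :: "zpoly fract set" where
  "laurent_ring = {f. \<exists>e p. to_fract (\<Prod>i<10. indet i) ^ e * f = to_fract p}"

lemma to_fract_power: "to_fract (p ^ n) = to_fract p ^ n"
  by (induction n) simp_all

lemma to_fract_of_int: "to_fract (of_int c) = of_int c"
  by (induction c rule: int_induct[of _ 0]) simp_all

lemma indet_nonzero [simp]: "indet i \<noteq> 0"
  by (metis indet_def single_zero lookup_single_eq lookup_zero zero_neq_one)

lemma laurent_ringI: "to_fract (\<Prod>i<10. indet i) ^ e * f = to_fract p \<Longrightarrow> f \<in> laurent_ring"
  unfolding laurent_ring_def by blast

lemma laurent_ringE:
  assumes "f \<in> laurent_ring"
  obtains e p where "to_fract (\<Prod>i<10. indet i) ^ e * f = to_fract p"
  using assms unfolding laurent_ring_def by blast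

lemma laurent_to_fract [intro, simp]: "to_fract p \<in> laurent_ring"
  by (rule laurent_ringI[of 0]) simp

lemma laurent_1 [simp]: "1 \<in> laurent_ring"
  using laurent_to_fract[of 1] by simp

lemma laurent_mult [intro]:
  assumes "f \<in> laurent_ring" "g \<in> laurent_ring"
  shows "f * g \<in> laurent_ring"
proof -
  obtain e p where p: "to_fract (\<Prod>i<10. indet i) ^ e * f = to_fract p" using assms(1) by (rule laurent_ringE)
  obtain e' q where q: "to_fract (\<Prod>i<10. indet i) ^ e' * g = to_fract q"
    using assms(2) by (rule laurent_ringE)
  show ?thesis
    by (rule laurent_ringI[of "e + e'" _ "p * q"]) (simp add: power_add ac_simps flip: p q)
qed

lemma laurent_combine:
  assumes "f \<in> laurent_ring" "g \<in> laurent_ring"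
  shows "f + g \<in> laurent_ring" and "f - g \<in> laurent_ring"
proof -
  let ?U = "\<Prod>i<10. indet i"
  obtain e p where p: "to_fract ?U ^ e * f = to_fract p" using assms(1) by (rule laurent_ringE)
  obtain e' q where q: "to_fract ?U ^ e' * g = to_fract q" using assms(2) by (rule laurent_ringE)
  have f: "to_fract ?U ^ (e + e') * f = to_fract (?U ^ e' * p)"
    using p by (simp add: power_add to_fract_power ac_simps)
  have g: "to_fract ?U ^ (e + e') * g = to_fract (?U ^ e * q)"
    using q by (simp add: power_add to_fract_power ac_simps)
  show "f + g \<in> laurent_ring" "f - g \<in> laurent_ring"
    using f g by (auto intro!: laurent_ringI[of "e + e'"] simp: distrib_left right_diff_distrib
      simp flip: to_fract_add to_fract_diff simp del: to_fract_mult)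
qed

lemmas laurent_add [intro] = laurent_combine(1)
  and laurent_diff [intro] = laurent_combine(2)

lemma laurent_power [intro]: "f \<in> laurent_ring \<Longrightarrow> f ^ n \<in> laurent_ring"
  by (induction n) auto

lemma laurent_prod: "(\<And>i. i \<in> A \<Longrightarrow> f i \<in> laurent_ring) \<Longrightarrow> prod f A \<in> laurent_ring"
  by (induction A rule: infinite_finite_induct) auto

lemma laurent_inverse_X [intro]:
  assumes "i < 10"
  shows "inverse (X i) \<in> laurent_ring"
proof (rule laurent_ringI[of 1])
  have "(\<Prod>i<10. indet i) = indet i * (\<Prod>j\<in>{..<10} - {i}. indet j)"
    using assms by (intro prod.remove) auto
  then show "to_fract (\<Prod>i<10. indet i) ^ 1 * inverse (X i) = to_fract (\<Prod>j\<in>{..<10} - {i}. indet j)"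
    by (simp add: field_simps)
qed

lemma laurent_divide_X: "f \<in> laurent_ring \<Longrightarrow> i < 10 \<Longrightarrow> f / X i \<in> laurent_ring"
  unfolding divide_inverse by auto

lemma eval_zpoly_const: "eval_zpoly t (Poly_Mapping.single 0 c) = of_int c"
  by (simp add: eval_zpoly_single)

lemma eval_zpoly_X: "eval_zpoly X p = to_fract p"
proof (induction p rule: zpoly_induct)
  case (const c)
  have "Poly_Mapping.single 0 (of_int c) = (of_int c :: zpoly)"
    by (rule single_of_int)
  then have "Poly_Mapping.single 0 c = (of_int c :: zpoly)"
    by simp
  then show ?case
    unfolding eval_zpoly_const by (simp only: to_fract_of_int)
qed simp_all

lemma laurent_eval_zpoly:
  assumes "\<And>i. t i \<in> laurent_ring"
  shows "eval_zpoly t p \<in> laurent_ring"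
proof (induction p rule: zpoly_induct)
  case (const c)
  show ?case
    by (metis eval_zpoly_const eval_zpoly_X laurent_to_fract)
qed (use assms in auto)

text \<open>Substitution into a Laurent polynomial, as a relation: it avoids choosing the numerator.\<close>

definition laurent_value :: "(nat \<Rightarrow> 'f::field) \<Rightarrow> zpoly fract \<Rightarrow> 'f \<Rightarrow> bool" where
  "laurent_value t f r \<longleftrightarrow> (\<exists>e p. to_fract (\<Prod>i<10. indet i) ^ e * f = to_fract p \<and>
     eval_zpoly t p = (\<Prod>i<10. t i) ^ e * r)"

lemma laurent_valueI:
  "to_fract (\<Prod>i<10. indet i) ^ e * f = to_fract p \<Longrightarrow> eval_zpoly t p = (\<Prod>i<10. t i) ^ e * r \<Longrightarrow>
    laurent_value t f r"
  unfolding laurent_value_def by blast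

lemma laurent_valueE:
  assumes "laurent_value t f r"
  obtains e p where "to_fract (\<Prod>i<10. indet i) ^ e * f = to_fract p"
    "eval_zpoly t p = (\<Prod>i<10. t i) ^ e * r"
  using assms unfolding laurent_value_def by blast

lemma laurent_value_X: "laurent_value t (X i) (t i)"
  by (rule laurent_valueI[of 0 _ "indet i"]) simp_all

lemma laurent_value_0: "laurent_value t 0 0"
  by (rule laurent_valueI[of 0 _ 0]) simp_all

lemma laurent_value_mult:
  assumes "laurent_value t f r" "laurent_value t g s"
  shows "laurent_value t (f * g) (r * s)"
proof -
  obtain e p where 1: "to_fract (\<Prod>i<10. indet i) ^ e * f = to_fract p"
    "eval_zpoly t p = (\<Prod>i<10. t i) ^ e * r" using assms(1) by (rule laurent_valueE)
  obtain e' q where 2: "to_fract (\<Prod>i<10. indet i) ^ e' * g = to_fract q"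
    "eval_zpoly t q = (\<Prod>i<10. t i) ^ e' * s" using assms(2) by (rule laurent_valueE)
  show ?thesis
    by (rule laurent_valueI[of "e + e'" _ "p * q"])
      (simp add: power_add ac_simps flip: 1(1) 2(1), simp add: 1(2) 2(2) power_add ac_simps)
qed

lemma laurent_value_combine:
  assumes "laurent_value t f r" "laurent_value t g s"
  shows "laurent_value t (f + g) (r + s)" and "laurent_value t (f - g) (r - s)"
proof -
  let ?U = "\<Prod>i<10. indet i"
  obtain e p where 1: "to_fract ?U ^ e * f = to_fract p"
    "eval_zpoly t p = (\<Prod>i<10. t i) ^ e * r" using assms(1) by (rule laurent_valueE)
  obtain e' q where 2: "to_fract ?U ^ e' * g = to_fract q"
    "eval_zpoly t q = (\<Prod>i<10. t i) ^ e' * s" using assms(2) by (rule laurent_valueE)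
  have f: "to_fract ?U ^ (e + e') * f = to_fract (?U ^ e' * p)"
    using 1(1) by (simp add: power_add to_fract_power ac_simps)
  have g: "to_fract ?U ^ (e + e') * g = to_fract (?U ^ e * q)"
    using 2(1) by (simp add: power_add to_fract_power ac_simps)
  have U: "eval_zpoly t ?U = (\<Prod>i<10. t i)"
    by (simp add: eval_zpoly_prod)
  show "laurent_value t (f + g) (r + s)"
    by (rule laurent_valueI[of "e + e'" _ "?U ^ e' * p + ?U ^ e * q"])
      (simp add: distrib_left f g del: to_fract_mult,
       simp add: U 1(2) 2(2) power_add algebra_simps)
  show "laurent_value t (f - g) (r - s)"
    by (rule laurent_valueI[of "e + e'" _ "?U ^ e' * p - ?U ^ e * q"])
      (simp add: right_diff_distrib f g del: to_fract_mult,
       simp add: U 1(2) 2(2) power_add algebra_simps)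
qed

text \<open>Cross-multiplying the two representations gives an identity of polynomials. It survives
  evaluation, and the evaluated denominators cancel because they are nonzero.\<close>

lemma laurent_value_unique:
  assumes "laurent_value t f r" "laurent_value t f s"
    and t: "\<And>i. i < 10 \<Longrightarrow> t i \<noteq> 0"
  shows "r = s"
proof -
  let ?U = "\<Prod>i<10. indet i"
  obtain e p where 1: "to_fract ?U ^ e * f = to_fract p"
    "eval_zpoly t p = (\<Prod>i<10. t i) ^ e * r" using assms(1) by (rule laurent_valueE)
  obtain e' q where 2: "to_fract ?U ^ e' * f = to_fract q"
    "eval_zpoly t q = (\<Prod>i<10. t i) ^ e' * s" using assms(2) by (rule laurent_valueE)
  have U: "eval_zpoly t ?U = (\<Prod>i<10. t i)"
    by (simp add: eval_zpoly_prod)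
  have nz: "(\<Prod>i<10. t i) \<noteq> 0"
    using t by simp
  have "to_fract (?U ^ e' * p) = to_fract (?U ^ e * q)"
    using 1(1) 2(1) by (simp add: to_fract_power flip: 1(1) 2(1))
  then have "?U ^ e' * p = ?U ^ e * q"
    by (simp only: to_fract_eq_iff)
  then have "eval_zpoly t (?U ^ e' * p) = eval_zpoly t (?U ^ e * q)"
    by (rule arg_cong)
  then have "(\<Prod>i<10. t i) ^ (e + e') * r = (\<Prod>i<10. t i) ^ (e + e') * s"
    by (simp add: U 1(2) 2(2) power_add ac_simps)
  with nz show ?thesis by simp
qed

lemma laurent_value_exists:
  assumes t: "\<And>i. i < 10 \<Longrightarrow> t i \<noteq> (0::'f::field)" and "f \<in> laurent_ring"
  shows "\<exists>r. laurent_value t f r"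
proof -
  obtain e p where "to_fract (\<Prod>i<10. indet i) ^ e * f = to_fract p"
    using assms(2) by (rule laurent_ringE)
  then have "laurent_value t f (eval_zpoly t p / (\<Prod>i<10. t i) ^ e)"
    by (rule laurent_valueI) (simp add: t)
  then show ?thesis ..
qed


section \<open>The recurrence\<close>

function orbit :: "(nat \<Rightarrow> 'f::field) \<Rightarrow> nat \<Rightarrow> 'f" where
  "orbit t n = (if n < 10 then t n else
     (t (10 + (n - 10) mod 3) * orbit t (n - 1) * orbit t (n - 9)
      - t (13 + (n - 10) mod 3) * orbit t (n - 4) * orbit t (n - 6)) / orbit t (n - 10))"
  by pat_completeness auto
termination by (relation "measure snd") auto

declare orbit.simps [simp del]

lemma orbit_initial: "n < 10 \<Longrightarrow> orbit t n = t n"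
  by (simp add: orbit.simps)

lemma orbit_step:
  "orbit t (n + 10) = (t (10 + n mod 3) * orbit t (n + 9) * orbit t (n + 1)
      - t (13 + n mod 3) * orbit t (n + 6) * orbit t (n + 4)) / orbit t n"
  by (subst orbit.simps) (simp add: add.commute)

lemma orbit_relation:
  "orbit t n \<noteq> 0 \<Longrightarrow> orbit t n * orbit t (n + 10) = t (10 + n mod 3) * orbit t (n + 9) * orbit t (n + 1)
      - t (13 + n mod 3) * orbit t (n + 6) * orbit t (n + 4)"
  unfolding orbit_step by (rule nonzero_mult_div_cancel_left[of "orbit t n", folded times_divide_eq_right])

text \<open>Data of the recurrence restarted at u_k: the window of ten terms from there on, with
  both coefficient triples rotated by \<open>k\<close>. The default 1 is Laurent, as substitution
  asks of every entry.\<close>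

definition shift :: "nat \<Rightarrow> (nat \<Rightarrow> 'f::field) \<Rightarrow> nat \<Rightarrow> 'f" where
  "shift k t i = (if i < 10 then orbit t (i + k)
     else if i < 13 then t (10 + (i - 10 + k) mod 3)
     else if i < 16 then t (13 + (i - 13 + k) mod 3) else 1)"

lemma orbit_shift: "orbit (shift k t) n = orbit t (n + k)"
proof (induction n rule: less_induct)
  case (less n)
  show ?case
  proof (cases "n < 10")
    case True
    then show ?thesis by (simp add: orbit_initial shift_def)
  next
    case False
    then obtain m where n: "n = m + 10"
      by (metis add.commute le_Suc_ex not_less)
    have "m mod 3 < 3" by simp
    then have A: "shift k t (10 + m mod 3) = t (10 + (m + k) mod 3)"
      and B: "shift k t (13 + m mod 3) = t (13 + (m + k) mod 3)"
      by (simp_all add: shift_def mod_simps del: pos_mod_bound)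
    have "orbit t (n + k) = orbit t ((m + k) + 10)"
      by (simp add: n ac_simps)
    then show ?thesis
      unfolding n orbit_step A B
      using less.IH[of m] less.IH[of "m + 9"] less.IH[of "m + 1"] less.IH[of "m + 6"] less.IH[of "m + 4"]
      by (simp add: n orbit_step ac_simps)
  qed
qed

text \<open>The relation forces the value of u_n, because the value of its divisor is nonzero. Only
  terms serving as divisors must be nonzero at \<open>t\<close>; later ones may vanish, which
  permits specialisations with u_10 = 0.\<close>

lemma laurent_value_orbit:
  fixes t :: "nat \<Rightarrow> 'f::field"
  assumes t: "\<And>i. i < 10 \<Longrightarrow> t i \<noteq> 0"
    and laurent: "\<And>i. i \<le> n \<Longrightarrow> orbit X i \<in> laurent_ring"
    and nz: "\<And>i. i + 10 \<le> n \<Longrightarrow> orbit t i \<noteq> 0"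
  shows "laurent_value t (orbit X n) (orbit t n)"
  using laurent nz
proof (induction n rule: less_induct)
  case (less n)
  show ?case
  proof (cases "n < 10")
    case True
    then show ?thesis by (simp add: orbit_initial laurent_value_X)
  next
    case False
    then obtain m where n: "n = m + 10"
      by (metis add.commute le_Suc_ex not_less)
    have IH: "laurent_value t (orbit X i) (orbit t i)" if "i < n" for i
      using that by (intro less.IH less.prems) auto
    have m: "orbit t m \<noteq> 0" by (rule less.prems(2)) (simp add: n)
    have "orbit X m \<noteq> 0"
      using laurent_value_unique[OF IH[of m], of 0] laurent_value_0[of t] m t by (auto simp: n)
    then have rel: "orbit X m * orbit X n = X (10 + m mod 3) * orbit X (m + 9) * orbit X (m + 1)
        - X (13 + m mod 3) * orbit X (m + 6) * orbit X (m + 4)"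
      unfolding n by (rule orbit_relation)
    obtain r where r: "laurent_value t (orbit X n) r"
      using laurent_value_exists[of t "orbit X n"] t less.prems(1) by blast
    have "laurent_value t (orbit X m * orbit X n) (orbit t m * r)"
      using IH[of m] r n by (intro laurent_value_mult) simp_all
    moreover have "laurent_value t (orbit X m * orbit X n)
        (t (10 + m mod 3) * orbit t (m + 9) * orbit t (m + 1)
        - t (13 + m mod 3) * orbit t (m + 6) * orbit t (m + 4))"
      unfolding rel by (intro laurent_value_mult laurent_value_combine(2) laurent_value_X IH) (simp_all add: n)
    ultimately have "orbit t m * r = t (10 + m mod 3) * orbit t (m + 9) * orbit t (m + 1)
        - t (13 + m mod 3) * orbit t (m + 6) * orbit t (m + 4)"
      by (rule laurent_value_unique) (rule t)
    then have "orbit t m * r = orbit t m * orbit t n"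
      unfolding n by (simp only: orbit_relation[OF m])
    with m r show ?thesis by simp
  qed
qed


section \<open>Nonvanishing, and the terms up to u_20\<close>

lemma orbit_X_nonzero:
  assumes "\<And>i. i \<le> n \<Longrightarrow> orbit X i \<in> laurent_ring"
  shows "orbit X n \<noteq> 0"
proof -
  \<comment> \<open>With all initial values 1, A = 2 and B = 1, the orbit is constantly 1 because 2
    - 1 = 1; a term with value 1 cannot be 0.\<close>
  define t :: "nat \<Rightarrow> rat" where "t i = (if 10 \<le> i \<and> i < 13 then 2 else 1)" for i
  have one: "orbit t m = 1" for m
  proof (induction m rule: less_induct)
    case (less m)
    have "t (10 + k mod 3) = 2" "t (13 + k mod 3) = 1" "m < 10 \<Longrightarrow> t m = 1" for k
      by (simp_all add: t_def)
    then show ?case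
      by (subst orbit.simps) (simp add: less.IH)
  qed
  have "laurent_value t (orbit X n) 1"
    using laurent_value_orbit[of t n] assms by (simp add: one t_def)
  moreover have "1 = (0::rat)" if "laurent_value t 0 1"
    using that laurent_value_0 by (rule laurent_value_unique) (simp add: t_def)
  ultimately show ?thesis by auto
qed

lemma laurent_orbit_initial: "n < 20 \<Longrightarrow> orbit X n \<in> laurent_ring"
proof (induction n rule: less_induct)
  case (less n)
  show ?case
  proof (cases "n < 10")
    case True
    then show ?thesis by (simp add: orbit_initial)
  next
    case False
    then obtain m where n: "n = m + 10"
      by (metis add.commute le_Suc_ex not_less)
    then have "m < 10" using less.prems by simp
    then show ?thesis
      unfolding n orbit_step orbit_initial[OF \<open>m < 10\<close>]
      by (intro laurent_divide_X laurent_diff laurent_mult laurent_to_fract less.IH)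
        (simp_all add: n)
  qed
qed

text \<open>The numerator of u_20 over the denominator u_1 u_4 u_6 u_9, found by expanding the
  relation for u_20 and cancelling u_10. The last summand comes from the terms that form the
  numerator of u_10.\<close>

definition confined :: "(nat \<Rightarrow> 'f::field) \<Rightarrow> 'f" where
  "confined t = (let u = orbit t in
     t 11 * u 4 * u 6 * (t 10 * t 11 * u 18 * u 10 * u 2 - t 10 * t 14 * u 18 * u 7 * u 5
       - t 11 * t 13 * u 15 * u 13 * u 2)
     + t 14 * u 1 * u 9 * (t 10 * t 14 * u 15 * u 7 * u 8 + t 11 * t 13 * u 12 * u 13 * u 5
       - t 13 * t 14 * u 12 * u 10 * u 8)
     - t 11 * t 14 * u 0 * u 5 * u 7 * u 13 * u 15)"

text \<open>Singularity confinement: modulo \<open>u\<^sub>1\<^sub>0\<close> the numerator of \<open>u\<^sub>2\<^sub>0\<close> becomes a multiple of the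
  numerator of \<open>u\<^sub>1\<^sub>0\<close> itself.\<close>

lemma orbit_20:
  assumes "\<And>i. i \<le> 10 \<Longrightarrow> orbit t i \<noteq> 0"
  shows "orbit t 20 * (orbit t 1 * orbit t 4 * orbit t 6 * orbit t 9) = confined t"
proof -
  define u where "u = orbit t"
  have rel: "u n * u (n + 10) = t (10 + n mod 3) * u (n + 9) * u (n + 1)
      - t (13 + n mod 3) * u (n + 6) * u (n + 4)" if "n \<le> 10" for n
    using orbit_relation assms that unfolding u_def by blast
  have r20: "u 10 * u 20 = t 11 * u 19 * u 11 - t 14 * u 16 * u 14"
    using rel[of 10] by simp
  have r19: "u 9 * u 19 = t 10 * u 18 * u 10 - t 13 * u 15 * u 13"
    using rel[of 9] by simp
  have r16: "u 6 * u 16 = t 10 * u 15 * u 7 - t 13 * u 12 * u 10"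
    using rel[of 6] by simp
  have r14: "u 4 * u 14 = t 11 * u 13 * u 5 - t 14 * u 10 * u 8"
    using rel[of 4] by simp
  have r11: "u 1 * u 11 = t 11 * u 10 * u 2 - t 14 * u 7 * u 5"
    using rel[of 1] by (simp add: numeral_2_eq_2)
  have r10: "u 0 * u 10 = t 10 * u 9 * u 1 - t 13 * u 6 * u 4"
    using rel[of 0] by simp
  \<comment> \<open>The factor u_1 u_4 u_6 u_9 clears the denominators of u_11, u_14, u_16 and
    u_19.\<close>
  have "u 10 * (u 20 * (u 1 * u 4 * u 6 * u 9)) =
      t 11 * (u 9 * u 19) * (u 1 * u 11) * (u 4 * u 6) - t 14 * (u 6 * u 16) * (u 4 * u 14) * (u 1 * u 9)"
    using arg_cong[OF r20, of "\<lambda>x. x * (u 1 * u 4 * u 6 * u 9)"] by (simp add: algebra_simps)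
  also have "\<dots> = u 10 * (confined t + t 11 * t 14 * u 0 * u 5 * u 7 * u 13 * u 15)
      - t 11 * t 14 * u 5 * u 7 * u 13 * u 15 * (t 10 * u 9 * u 1 - t 13 * u 6 * u 4)"
    unfolding r19 r16 r14 r11 confined_def Let_def u_def[symmetric] by (simp add: algebra_simps)
  also have "\<dots> = u 10 * confined t"
    unfolding r10[symmetric] by (simp add: algebra_simps)
  finally show ?thesis
    using assms[of 10] unfolding u_def by simp
qed

lemma laurent_orbit_20: "orbit X 20 \<in> laurent_ring"
proof -
  have nz: "orbit X i \<noteq> 0" if "i \<le> 10" for i
    using that by (intro orbit_X_nonzero laurent_orbit_initial) simp
  have "confined X \<in> laurent_ring"
    unfolding confined_def Let_def
    by (intro laurent_diff laurent_add laurent_mult laurent_to_fract laurent_orbit_initial) simp_all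
  then have "confined X / X 1 / X 4 / X 6 / X 9 \<in> laurent_ring"
    by (intro laurent_divide_X) simp_all
  also have "confined X / X 1 / X 4 / X 6 / X 9 = orbit X 20"
    using orbit_20[OF nz] by (simp add: orbit_initial field_simps)
  finally show ?thesis .
qed


section \<open>Divisibility by the tenth term\<close>

definition orbit_10_dvd :: "zpoly fract \<Rightarrow> bool" where
  "orbit_10_dvd f \<longleftrightarrow> (\<exists>g\<in>laurent_ring. f = orbit X 10 * g)"

lemma orbit_10: "orbit t 10 = (t 10 * t 9 * t 1 - t 13 * t 6 * t 4) / t 0"
  using orbit_step[of t 0] by (simp add: orbit_initial)

lemma orbit_10_dvdI: "g \<in> laurent_ring \<Longrightarrow> f = orbit X 10 * g \<Longrightarrow> orbit_10_dvd f"
  unfolding orbit_10_dvd_def by blast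

lemma orbit_10_dvdE:
  assumes "orbit_10_dvd f"
  obtains g where "g \<in> laurent_ring" "f = orbit X 10 * g"
  using assms unfolding orbit_10_dvd_def by blast

lemma orbit_10_dvd_0: "orbit_10_dvd 0"
  using laurent_to_fract[of 0] by (intro orbit_10_dvdI[of 0]) simp_all

lemma orbit_10_dvd_add:
  assumes "orbit_10_dvd f" "orbit_10_dvd g"
  shows "orbit_10_dvd (f + g)"
  using assms by (elim orbit_10_dvdE) (rule orbit_10_dvdI[OF laurent_add], simp_all only: distrib_left)

lemma orbit_10_dvd_mult:
  assumes "orbit_10_dvd f" "g \<in> laurent_ring"
  shows "orbit_10_dvd (g * f)"
  using assms
  by (elim orbit_10_dvdE) (rule orbit_10_dvdI[OF laurent_mult[of g]], simp_all only: mult.left_commute)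

text \<open>Substituting \<open>A\<^sub>0\<close>, which is \<^term>\<open>X 10\<close>, by the Laurent monomial that makes \<open>u\<^sub>1\<^sub>0\<close> vanish has as kernel the ideal
  generated by \<open>u\<^sub>1\<^sub>0\<close>, so \<open>u\<^sub>1\<^sub>0\<close> is prime.\<close>

definition kill :: "nat \<Rightarrow> zpoly fract" where
  "kill = X(10 := X 13 * X 6 * X 4 / (X 9 * X 1))"

lemma kill_laurent: "kill i \<in> laurent_ring"
proof -
  have "X 13 * X 6 * X 4 / X 9 / X 1 \<in> laurent_ring"
    by (intro laurent_divide_X laurent_mult laurent_to_fract) simp_all
  then show ?thesis by (simp add: kill_def)
qed

text \<open>For the one changed indeterminate, \<open>X 10 - kill 10\<close> is u_10 times the unit
  \<open>X 0 / X 9 / X 1\<close>; congruence modulo an ideal passes to sums and products.\<close>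

lemma kill_congruence: "orbit_10_dvd (to_fract p - eval_zpoly kill p)"
proof (induction p rule: zpoly_induct)
  case (const c)
  have "to_fract (Poly_Mapping.single 0 c) = (of_int c :: zpoly fract)"
    by (rule trans[OF eval_zpoly_X[symmetric] eval_zpoly_const])
  then show ?case
    using orbit_10_dvd_0 by (simp only: eval_zpoly_const diff_self)
next
  case (indet i)
  show ?case
  proof (cases "i = 10")
    case True
    have split: "x - m / (r * s) = (x * r * s - m) / z * (z / r / s)" if "r \<noteq> 0" "s \<noteq> 0" "z \<noteq> 0"
      for x m r s z :: "zpoly fract"
      using that by (simp add: field_simps)
    have "X 10 - kill 10 = orbit X 10 * (X 0 / X 9 / X 1)"
      unfolding kill_def orbit_10 fun_upd_same by (rule split) simp_all
    then show ?thesis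
      unfolding True eval_zpoly_indet
      by (rule orbit_10_dvdI[rotated]) (intro laurent_divide_X laurent_to_fract, simp_all)
  next
    case False
    then show ?thesis
      using orbit_10_dvd_0 by (simp add: kill_def)
  qed
next
  case (add p q)
  have "to_fract (p + q) - eval_zpoly kill (p + q) =
      (to_fract p - eval_zpoly kill p) + (to_fract q - eval_zpoly kill q)"
    by simp
  with orbit_10_dvd_add[OF add] show ?case by (simp only:)
next
  case (mult p q)
  have "to_fract (p * q) - eval_zpoly kill (p * q) =
      to_fract p * (to_fract q - eval_zpoly kill q) + eval_zpoly kill q * (to_fract p - eval_zpoly kill p)"
    by (simp add: algebra_simps)
  moreover have "orbit_10_dvd \<dots>"
    by (intro orbit_10_dvd_add orbit_10_dvd_mult mult laurent_to_fract laurent_eval_zpoly kill_laurent)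
  ultimately show ?case by (simp only:)
qed

lemma kill_nonzero: "i < 10 \<Longrightarrow> kill i \<noteq> 0"
  by (simp add: kill_def)

text \<open>The numerator is congruent to its image 0 modulo u_10, and the denominator is a unit of
  the Laurent ring.\<close>

lemma orbit_10_dvd_if_killed:
  assumes "laurent_value kill f 0"
  shows "orbit_10_dvd f"
proof -
  obtain e p where p: "to_fract (\<Prod>i<10. indet i) ^ e * f = to_fract p" "eval_zpoly kill p = 0"
    using assms by (rule laurent_valueE) simp
  have "to_fract (prod f A) = (\<Prod>i\<in>A. to_fract (f i))" for f :: "nat \<Rightarrow> zpoly" and A
    by (induction A rule: infinite_finite_induct) simp_all
  then have U: "inverse (to_fract (\<Prod>i<10. indet i) ^ e) = (\<Prod>i<10. inverse (X i)) ^ e"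
    by (simp only: power_inverse[symmetric] prod_inversef[symmetric] o_def)
  have "orbit_10_dvd (inverse (to_fract (\<Prod>i<10. indet i) ^ e) * to_fract p)"
    using kill_congruence[of p] unfolding U p(2)
    by (intro orbit_10_dvd_mult laurent_power laurent_prod laurent_inverse_X) auto
  also have "inverse (to_fract (\<Prod>i<10. indet i) ^ e) * to_fract p = f"
    unfolding p(1)[symmetric] by simp
  finally show ?thesis .
qed

lemma laurent_value_kill_orbit_10: "laurent_value kill (orbit X 10) 0"
proof -
  have "laurent_value kill (orbit X 10) (orbit kill 10)"
    by (rule laurent_value_orbit) (simp_all add: kill_nonzero orbit_initial laurent_orbit_initial)
  moreover have "orbit kill 10 = 0"
    by (simp add: orbit_10 kill_def)
  ultimately show ?thesis by simp
qed

lemma laurent_value_kill_exists: "f \<in> laurent_ring \<Longrightarrow> \<exists>r. laurent_value kill f r"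
  by (rule laurent_value_exists) (rule kill_nonzero)

text \<open>Values under \<open>kill\<close> lie in a field, so one of the two factors has value 0
  and is therefore a multiple of u_10.\<close>

lemma orbit_10_prime:
  assumes f: "f \<in> laurent_ring" and g: "g \<in> laurent_ring" and "orbit_10_dvd (f * g)"
  shows "orbit_10_dvd f \<or> orbit_10_dvd g"
proof -
  obtain k where k: "k \<in> laurent_ring" "f * g = orbit X 10 * k"
    using assms(3) unfolding orbit_10_dvd_def by blast
  obtain r where r: "laurent_value kill f r" using laurent_value_kill_exists[OF f] ..
  obtain s where s: "laurent_value kill g s" using laurent_value_kill_exists[OF g] ..
  obtain q where q: "laurent_value kill k q" using laurent_value_kill_exists[OF k(1)] ..
  have "laurent_value kill (f * g) (r * s)"
    using r s by (rule laurent_value_mult)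
  moreover have "laurent_value kill (f * g) (0 * q)"
    unfolding k(2) using laurent_value_kill_orbit_10 q by (rule laurent_value_mult)
  ultimately have "r * s = 0 * q"
    by (rule laurent_value_unique) (rule kill_nonzero)
  then show ?thesis
    using r s orbit_10_dvd_if_killed by auto
qed

text \<open>An explicit rational orbit passing through the singularity \<open>u\<^sub>1\<^sub>0 = 0\<close> with all of
  \<open>u\<^sub>1\<^sub>1, \<dots>, u\<^sub>2\<^sub>0\<close> nonzero.\<close>

lemma orbit_10_not_dvd:
  assumes "11 \<le> i" "i \<le> 20"
  shows "\<not> orbit_10_dvd (orbit X i)"
proof
  \<comment> \<open>All six coefficients are 1, and the signs give u_9 u_1 = u_6 u_4, hence u_10 =
    0.\<close>
  define t :: "nat \<Rightarrow> rat" where "t i = (if i \<in> {4, 6, 7} then -1 else 1)" for i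
  have t_nz: "t j \<noteq> 0" for j
    by (simp add: t_def)
  have init: "orbit t 0 = 1" "orbit t 1 = 1" "orbit t 2 = 1" "orbit t 3 = 1" "orbit t 4 = -1"
    "orbit t 5 = 1" "orbit t 6 = -1" "orbit t 7 = -1" "orbit t 8 = 1" "orbit t 9 = 1"
    by (simp_all add: orbit_initial t_def)
  have step: "orbit t (n + 10) = (orbit t (n + 9) * orbit t (n + 1)
      - orbit t (n + 6) * orbit t (n + 4)) / orbit t n" for n
    unfolding orbit_step by (simp add: t_def)
  have o10: "orbit t 10 = 0" using step[of 0] init by simp
  have o11: "orbit t 11 = 1" using step[of 1] init o10 by simp
  have o12: "orbit t 12 = 2" using step[of 2] init o11 by simp
  have o13: "orbit t 13 = -1" using step[of 3] init o12 by simp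
  have o14: "orbit t 14 = 1" using step[of 4] init o10 o13 by simp
  have o15: "orbit t 15 = -2" using step[of 5] init o11 o14 by simp
  have o16: "orbit t 16 = -2" using step[of 6] init o10 o12 o15 by simp
  have o17: "orbit t 17 = 1" using step[of 7] init o11 o13 o16 by simp
  have o18: "orbit t 18 = -1" using step[of 8] init o12 o14 o17 by simp
  have o19: "orbit t 19 = -2" using step[of 9] init o10 o13 o15 o18 by simp
  note vals = init o10 o11 o12 o13 o14 o15 o16 o17 o18 o19
  \<comment> \<open>Terms before u_20 divide by initial values only, so u_10 = 0 does no
    harm.\<close>
  have val: "laurent_value t (orbit X j) (orbit t j)" if "j < 20" for j
    using that by (intro laurent_value_orbit t_nz laurent_orbit_initial) (simp_all add: orbit_initial t_nz)
  assume "orbit_10_dvd (orbit X i)"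
  then obtain g where g: "g \<in> laurent_ring" "orbit X i = orbit X 10 * g"
    unfolding orbit_10_dvd_def by blast
  obtain r where r: "laurent_value t g r"
    using laurent_value_exists[of t g] t_nz g(1) by blast
  have "laurent_value t (orbit X 10 * g) (orbit t 10 * r)"
    by (intro laurent_value_mult val r) simp
  then have i0: "laurent_value t (orbit X i) 0"
    by (simp only: g(2) o10 mult_zero_left)
  show False
  proof (cases "i = 20")
    case False
    with assms have i: "i = 11 \<or> i = 12 \<or> i = 13 \<or> i = 14 \<or> i = 15 \<or> i = 16 \<or> i = 17
        \<or> i = 18 \<or> i = 19"
      by presburger
    then have "i < 20" by auto
    have "orbit t i = 0"
      by (rule laurent_value_unique[OF val[OF \<open>i < 20\<close>] i0]) (rule t_nz)
    moreover have "orbit t i \<noteq> 0"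
      using i by (elim disjE) (simp_all add: vals)
    ultimately show False by simp
  next
    case True
    \<comment> \<open>The relation for u_20 would divide by u_10 = 0 here; \<open>confined\<close>
      gives a multiple of u_20 without this division.\<close>
    have nz: "orbit X j \<noteq> 0" if "j \<le> 10" for j
      using that by (intro orbit_X_nonzero laurent_orbit_initial) simp
    have o20: "orbit X 20 * (orbit X 1 * orbit X 4 * orbit X 6 * orbit X 9) = confined X"
      by (rule orbit_20) (rule nz)
    have "laurent_value t (confined X) (confined t)"
      unfolding confined_def Let_def
      by (intro laurent_value_combine laurent_value_mult laurent_value_X val) simp_all
    moreover have "laurent_value t (confined X)
        (0 * (orbit t 1 * orbit t 4 * orbit t 6 * orbit t 9))"
      unfolding o20[symmetric] by (intro laurent_value_mult val i0[unfolded True]) simp_all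
    ultimately have "confined t = 0 * (orbit t 1 * orbit t 4 * orbit t 6 * orbit t 9)"
      by (rule laurent_value_unique) (rule t_nz)
    moreover have "confined t = -1"
      by (simp add: confined_def vals t_def)
    ultimately show False by simp
  qed
qed

section \<open>Removal of the denominators\<close>

lemma laurent_cancel_orbit_10:
  assumes "orbit X 10 ^ e * f \<in> laurent_ring" "m * f \<in> laurent_ring"
    and m: "m \<in> laurent_ring" "\<not> orbit_10_dvd m"
  shows "f \<in> laurent_ring"
  using assms(1,2)
proof (induction e arbitrary: f)
  case 0
  then show ?case by simp
next
  case (Suc e)
  have u: "orbit X 10 \<in> laurent_ring" "orbit X 10 \<noteq> 0"
    by (auto intro!: orbit_X_nonzero laurent_orbit_initial)
  have *: "orbit X 10 * f \<in> laurent_ring"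
  proof (rule Suc.IH)
    show "orbit X 10 ^ e * (orbit X 10 * f) \<in> laurent_ring"
      using Suc.prems(1) by (simp add: ac_simps)
    have "orbit X 10 * (m * f) \<in> laurent_ring"
      using u Suc.prems(2) by blast
    then show "m * (orbit X 10 * f) \<in> laurent_ring"
      by (simp add: ac_simps)
  qed
  \<comment> \<open>The prime u_10 divides u_10 (m f) but not m, so it divides u_10 f within the
    Laurent ring; cancelling it shows that f is Laurent.\<close>
  have "orbit_10_dvd (m * (orbit X 10 * f))"
    unfolding orbit_10_dvd_def using Suc.prems(2) by (intro bexI[of _ "m * f"]) simp_all
  then have "orbit_10_dvd (orbit X 10 * f)"
    using orbit_10_prime[OF m(1) *] m(2) by blast
  then show ?case
    unfolding orbit_10_dvd_def using u by auto
qed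

lemma orbit_10_not_dvd_prod:
  assumes "finite A" "\<And>i. i \<in> A \<Longrightarrow> f i \<in> laurent_ring" "\<And>i. i \<in> A \<Longrightarrow> \<not> orbit_10_dvd (f i)"
  shows "\<not> orbit_10_dvd (prod f A)"
  using assms
proof (induction A rule: finite_induct)
  case empty
  show ?case
  proof
    assume "orbit_10_dvd (prod f {})"
    \<comment> \<open>If u_10 divided the empty product 1, it would divide u_11.\<close>
    then have "orbit_10_dvd (orbit X 11 * 1)"
      by (intro orbit_10_dvd_mult laurent_orbit_initial) simp_all
    with orbit_10_not_dvd[of 11] show False by simp
  qed
next
  case (insert i A)
  then show ?case
    using orbit_10_prime[of "f i" "prod f A"] laurent_prod[of A f] by auto
qed

text \<open>u_n is term n - k of the orbit restarted at u_k. The universal term of that index is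
  Laurent since k > 0, and substituting the window into it leaves a power of the product of the
  window as denominator. The bound \<open>k + 10 \<le> n\<close> keeps the window below n.\<close>

lemma laurent_orbit_shift:
  assumes laurent: "\<And>m. m < n \<Longrightarrow> orbit X m \<in> laurent_ring" and "0 < k" "k + 10 \<le> n"
  shows "\<exists>e. (\<Prod>i<10. orbit X (i + k)) ^ e * orbit X n \<in> laurent_ring"
proof -
  define t where "t = shift k X"
  have nz: "orbit X m \<noteq> 0" if "m < n" for m
    using that by (intro orbit_X_nonzero laurent) simp
  have t: "t i = orbit X (i + k)" if "i < 10" for i
    using that by (simp add: t_def shift_def)
  have t_laurent: "t i \<in> laurent_ring" for i
    using assms by (auto simp: t_def shift_def)
  have "laurent_value t (orbit X (n - k)) (orbit t (n - k))"
  proof (rule laurent_value_orbit)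
    show "t i \<noteq> 0" if "i < 10" for i
      using that assms(3) nz by (simp add: t)
    show "orbit X i \<in> laurent_ring" if "i \<le> n - k" for i
      using that assms(2,3) by (intro laurent) simp
    show "orbit t i \<noteq> 0" if "i + 10 \<le> n - k" for i
      using that assms(3) unfolding t_def orbit_shift by (intro nz) simp
  qed
  also have "orbit t (n - k) = orbit X n"
    using assms(3) by (simp add: t_def orbit_shift)
  finally obtain e p where p: "eval_zpoly t p = (\<Prod>i<10. t i) ^ e * orbit X n"
    by (rule laurent_valueE)
  have "(\<Prod>i<10. t i) = (\<Prod>i<10. orbit X (i + k))"
    by (simp add: t)
  with p laurent_eval_zpoly[of t p] t_laurent
  have "(\<Prod>i<10. orbit X (i + k)) ^ e * orbit X n \<in> laurent_ring"
    by simp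
  then show ?thesis ..
qed

theorem laurent_orbit: "orbit X n \<in> laurent_ring"
proof (induction n rule: less_induct)
  case (less n)
  consider "n < 20" | "n = 20" | "21 \<le> n" by linarith
  then show ?case
  proof cases
    case 1
    then show ?thesis by (rule laurent_orbit_initial)
  next
    case 2
    then show ?thesis using laurent_orbit_20 by simp
  next
    case 3
    obtain e where e: "(\<Prod>i<10. orbit X (i + 1)) ^ e * orbit X n \<in> laurent_ring"
      using laurent_orbit_shift[of n 1, OF less] 3 by force
    obtain e' where e': "(\<Prod>i<10. orbit X (i + 11)) ^ e' * orbit X n \<in> laurent_ring"
      using laurent_orbit_shift[of n 11, OF less] 3 by force
    \<comment> \<open>Nine of the ten terms of the first window are initial values, hence units;
      u_10 alone survives in the denominator.\<close>
    have "(\<Prod>i<10. orbit X (i + 1)) = (\<Prod>i<9. X (i + 1)) * orbit X 10"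
      using prod.lessThan_Suc[of "\<lambda>i. orbit X (i + 1)" 9] by (simp add: orbit_initial)
    moreover have "(\<Prod>i<9. X (i + 1)) \<noteq> 0"
      by simp
    ultimately have "orbit X 10 ^ e * orbit X n =
        inverse (\<Prod>i<9. X (i + 1)) ^ e * ((\<Prod>i<10. orbit X (i + 1)) ^ e * orbit X n)"
      by (simp add: power_mult_distrib power_inverse del: prod_zero_iff)
    also have "\<dots> \<in> laurent_ring"
      unfolding prod_inversef[symmetric] o_def
      by (intro laurent_mult laurent_power laurent_prod laurent_inverse_X e) auto
    finally have "orbit X 10 ^ e * orbit X n \<in> laurent_ring" .
    moreover note e'
    moreover have M: "(\<Prod>i<10. orbit X (i + 11)) \<in> laurent_ring"
      by (intro laurent_prod less) (use 3 in auto)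
    then have "(\<Prod>i<10. orbit X (i + 11)) ^ e' \<in> laurent_ring"
      by (rule laurent_power)
    moreover have "\<not> orbit_10_dvd (\<Prod>i<10. orbit X (i + 11))"
      by (intro orbit_10_not_dvd_prod orbit_10_not_dvd less) (use 3 in auto)
    then have "\<not> orbit_10_dvd ((\<Prod>i<10. orbit X (i + 11)) ^ e')"
      using orbit_10_not_dvd_prod[of "{..<e'}" "\<lambda>_. \<Prod>i<10. orbit X (i + 11)"] M by simp
    ultimately show ?thesis
      by (rule laurent_cancel_orbit_10)
  qed
qed


section \<open>The mapping as three steps of the recurrence\<close>

primrec position :: "coord \<Rightarrow> nat" where
  "position X0 = 0" | "position Y0 = 1" | "position Z1 = 2" | "position X1 = 3" | "position Y1 = 4"
| "position Z2 = 5" | "position X2 = 6" | "position Y2 = 7" | "position Z3 = 8" | "position X3 = 9"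

text \<open>The ones in the list are irrelevant padding: no index beyond 15 is ever used.\<close>

definition gd_data :: "'k \<Rightarrow> 'k \<Rightarrow> 'k \<Rightarrow> 'k \<Rightarrow> nat \<Rightarrow> (coord, 'k::field) ratfun" where
  "gd_data a b c d i =
    ([Var X0, Var Y0, Var Z1, Var X1, Var Y1, Var Z2, Var X2, Var Y2, Var Z3, Var X3,
      (Const a + Const b) / Const b, (Const a + Const d) / Const d, (Const a + Const c) / Const c,
      Const a / Const b, Const a / Const d, Const a / Const c] @ replicate i 1) ! i"

text \<open>One application of the mapping advances the sequence by three indices: the new y, z and
  x are the terms 3n + 10, 3n + 11 and 3n + 12, each computed from earlier terms only.\<close>

lemma gd_map_iterate_orbit:
  assumes "b \<noteq> 0" "c \<noteq> 0" "d \<noteq> 0"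
  shows "(gd_map (Const a) (Const b) (Const c) (Const d) ^^ n) Var v =
    orbit (gd_data a b c d) (3 * n + position v)"
proof (induction n arbitrary: v)
  case 0
  show ?case by (cases v) (simp_all add: orbit_initial gd_data_def)
next
  case (Suc n)
  let ?u = "orbit (gd_data a b c d)"
  have nz: "Const b \<noteq> (0 :: (coord, 'a) ratfun)" "Const c \<noteq> (0 :: (coord, 'a) ratfun)"
    "Const d \<noteq> (0 :: (coord, 'a) ratfun)"
    using assms value1_Const value1_nonzero by blast+
  have mods: "(3 * n + 1) mod 3 = 1" "(3 * n + 2) mod 3 = 2"
    by presburger+
  have sums: "3 * n + 1 + 10 = 3 * n + 11" "3 * n + 1 + 9 = 3 * n + 10" "3 * n + 1 + 6 = 3 * n + 7"
    "3 * n + 1 + 4 = 3 * n + 5" "3 * n + 1 + 1 = 3 * n + 2"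
    "3 * n + 2 + 10 = 3 * n + 12" "3 * n + 2 + 9 = 3 * n + 11" "3 * n + 2 + 6 = 3 * n + 8"
    "3 * n + 2 + 4 = 3 * n + 6" "3 * n + 2 + 1 = 3 * n + 3"
    by simp_all
  have y: "?u (3 * n + 10) = ((Const a + Const b) * ?u (3 * n + 9) * ?u (3 * n + 1)
      - Const a * ?u (3 * n + 6) * ?u (3 * n + 4)) / (Const b * ?u (3 * n))"
    unfolding orbit_step using nz by (simp add: gd_data_def diff_divide_distrib)
  have z: "?u (3 * n + 11) = ((Const a + Const d) * ?u (3 * n + 10) * ?u (3 * n + 2)
      - Const a * ?u (3 * n + 7) * ?u (3 * n + 5)) / (Const d * ?u (3 * n + 1))"
    unfolding orbit_step[of _ "3 * n + 1", unfolded sums mods]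
    using nz by (simp add: gd_data_def diff_divide_distrib)
  have x: "?u (3 * n + 12) = ((Const a + Const c) * ?u (3 * n + 3) * ?u (3 * n + 11)
      - Const a * ?u (3 * n + 6) * ?u (3 * n + 8)) / (Const c * ?u (3 * n + 2))"
    unfolding orbit_step[of _ "3 * n + 2", unfolded sums mods]
    using nz by (simp add: gd_data_def diff_divide_distrib mult_ac)
  have indices: "3 * Suc n + 0 = 3 * n + 3" "3 * Suc n + 1 = 3 * n + 4" "3 * Suc n + 2 = 3 * n + 5"
    "3 * Suc n + 3 = 3 * n + 6" "3 * Suc n + 4 = 3 * n + 7" "3 * Suc n + 5 = 3 * n + 8"
    "3 * Suc n + 6 = 3 * n + 9" "3 * Suc n + 7 = 3 * n + 10" "3 * Suc n + 8 = 3 * n + 11"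
    "3 * Suc n + 9 = 3 * n + 12" "3 * n + 0 = 3 * n"
    by simp_all
  show ?case
    unfolding funpow.simps(2) o_apply gd_map_def[of _ _ _ _ "(_ ^^ n) Var"] Let_def Suc.IH
    by (cases v) (simp_all only: position.simps indices x y z coord.case)
qed

text \<open>Specialising the universal result turns the coefficients into constants and the ten
  initial values into variables, so the numerator becomes a polynomial and the denominator a
  monomial.\<close>

lemma is_laurent_gd_data_orbit:
  fixes a b c d :: "'k::field"
  assumes nz: "b \<noteq> 0" "c \<noteq> 0" "d \<noteq> 0"
  shows "is_laurent (orbit (gd_data a b c d) n)"
proof -
  let ?t = "gd_data a b c d"
  \<comment> \<open>Each term is the coordinate \<open>X0\<close>, \<open>Y0\<close> or
    \<open>Z1\<close> of iterate \<open>m div 3\<close>, and coordinates of iterates are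
    nonzero.\<close>
  have orbit_nz: "orbit ?t m \<noteq> 0" for m
  proof -
    have "m = 3 * (m div 3) + m mod 3" "m mod 3 < 3" by simp_all
    moreover have "\<exists>v. j = position v" if "j < 3" for j
    proof -
      have "j = position X0 \<or> j = position Y0 \<or> j = position Z1"
        using that by auto
      then show ?thesis by blast
    qed
    ultimately obtain v where "m = 3 * (m div 3) + position v"
      by metis
    then show ?thesis
      using gd_map_iterate_nonzero[OF nz] gd_map_iterate_orbit[OF nz] by metis
  qed
  have t_nz: "?t i \<noteq> 0" if "i < 10" for i
    using orbit_nz[of i] that by (simp add: orbit_initial)
  have "laurent_value ?t (orbit X n) (orbit ?t n)"
    by (intro laurent_value_orbit t_nz laurent_orbit orbit_nz)
  then obtain e p where p: "eval_zpoly ?t p = (\<Prod>i<10. ?t i) ^ e * orbit ?t n"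
    by (rule laurent_valueE)
  \<comment> \<open>Nonzero constants are invertible, so the normalised coefficients are again
    constants and in particular polynomials.\<close>
  have quotient: "Const x / Const y = (to_fract (Poly_Mapping.single 0 (x / y)) :: (coord, 'k) ratfun)"
    if "y \<noteq> 0" for x y
  proof -
    have "Poly_Mapping.single (0 :: coord \<Rightarrow>\<^sub>0 nat) y \<noteq> 0"
      using that by (intro eval1_nonzero) simp
    then show ?thesis
      using that by (simp add: Const_def to_fract_def mult_single eq_fract)
  qed
  have sum: "Const x + Const y = (Const (x + y) :: (coord, 'k) ratfun)" for x y
    by (simp add: Const_def single_add)
  have var: "Var v = (to_fract (Poly_Mapping.single (Poly_Mapping.single v 1) 1) :: (coord, 'k) ratfun)" for v
    by (simp add: Var_def to_fract_def)
  have t_poly: "?t i \<in> range to_fract" for i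
  proof -
    have one: "1 \<in> range (to_fract :: ((coord \<Rightarrow>\<^sub>0 nat) \<Rightarrow>\<^sub>0 'k) \<Rightarrow> _)"
      by (metis rangeI to_fract_1)
    have "?t i \<in> set ([Var X0, Var Y0, Var Z1, Var X1, Var Y1, Var Z2, Var X2, Var Y2, Var Z3, Var X3,
      (Const a + Const b) / Const b, (Const a + Const d) / Const d, (Const a + Const c) / Const c,
      Const a / Const b, Const a / Const d, Const a / Const c] @ replicate i 1)"
      unfolding gd_data_def by (rule nth_mem) simp
    then show ?thesis
      using one by (auto simp: sum quotient nz var split: if_splits)
  qed
  have "eval_zpoly ?t q \<in> range to_fract" for q
  proof (induction q rule: zpoly_induct)
    case (const c)
    show ?case unfolding eval_zpoly_const by (metis rangeI to_fract_of_int)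
  next
    case (indet i)
    show ?case using t_poly by simp
  next
    case (add p q)
    then show ?case by (metis (no_types, lifting) eval_zpoly_add imageE rangeI to_fract_add)
  next
    case (mult p q)
    then show ?case by (metis (no_types, lifting) eval_zpoly_mult imageE rangeI to_fract_mult)
  qed
  then obtain p' where p': "eval_zpoly ?t p = to_fract p'"
    by blast
  have monomial: "\<exists>v. ?t i = Var v" if "i < 10" for i
  proof -
    have "i \<in> {0, 1, 2, 3, 4, 5, 6, 7, 8, 9}"
      using that by auto
    then show ?thesis
      by (elim insertE) (auto simp: gd_data_def)
  qed
  have "\<exists>m. (\<Prod>i<k. ?t i) = to_fract (Poly_Mapping.single m 1)" if "k \<le> 10" for k
    using that
  proof (induction k)
    case 0
    show ?case by (intro exI[of _ 0]) simp
  next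
    case (Suc k)
    then obtain m v where "(\<Prod>i<k. ?t i) = to_fract (Poly_Mapping.single m 1)" "?t k = Var v"
      using monomial by fastforce
    then show ?case
      by (intro exI[of _ "m + Poly_Mapping.single v 1"]) (simp add: var mult_single flip: to_fract_mult)
  qed
  then obtain m where m: "(\<Prod>i<10. ?t i) = to_fract (Poly_Mapping.single m 1)"
    by blast
  have "\<exists>m'. to_fract (Poly_Mapping.single m (1::'k)) ^ e = to_fract (Poly_Mapping.single m' 1)"
  proof (induction e)
    case 0
    show ?case by (intro exI[of _ 0]) simp
  next
    case (Suc e)
    then obtain m' where "to_fract (Poly_Mapping.single m (1::'k)) ^ e = to_fract (Poly_Mapping.single m' 1)"
      by blast
    then show ?case
      by (intro exI[of _ "m + m'"]) (simp add: mult_single flip: to_fract_mult)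
  qed
  then obtain m' where m': "(\<Prod>i<10. ?t i) ^ e = to_fract (Poly_Mapping.single m' 1)"
    unfolding m by blast
  have "(\<Prod>i<10. ?t i) ^ e \<noteq> 0"
    using t_nz by simp
  with p have "orbit ?t n = Fraction_Field.Fract p' (Poly_Mapping.single m' 1)"
    unfolding p' m' Fract_conv_to_fract by (simp add: field_simps)
  then show ?thesis
    unfolding is_laurent_def by blast
qed

theorem proposition4:
  fixes a b c d :: "'k::field_char_0"
  assumes "b \<noteq> 0" and "c \<noteq> 0" and "d \<noteq> 0"
  shows "laurent_property (gd_map (Const a) (Const b) (Const c) (Const d))"
  unfolding laurent_property_def gd_map_iterate_orbit[OF assms]
  using is_laurent_gd_data_orbit[OF assms] by blast

end
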